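(* Let $A$ be a $C^*$-algebra, $X$ a Hilbert $A$-module, $\mathcal{H},\mathcal{K}$ Hilbert spaces, $\varphi:A\to L(\mathcal{H})$ a completely positive linear map, $\Phi:X\to L(\mathcal{H},\mathcal{K})$ a $\varphi$-map and $x_0\in X$. Then $x_0\in X_\Phi$ if and only if $\langle x_0,x_0\rangle\in M_\varphi$ and $\varphi(b^*\langle x_0,x_0\rangle b)=\varphi(b^* )\varphi(\langle x_0,x_0\rangle)\varphi(b)$ for all $b\in A$.
   Context: Hilbert $C^*$-modules are right modules, with inner product linear in the second variable. $L(\mathcal{H},\mathcal{K})$ denotes the bounded linear operators from $\mathcal{H}$ to $\mathcal{K}$, and $L(\mathcal{H})=L(\mathcal{H},\mathcal{H})$. A map $\Phi:X\to L(\mathcal{H},\mathcal{K})$ is a $\varphi$-map if $\Phi(x)^*\Phi(y)=\varphi(\langle x,y\rangle)$ for all $x,y\in X$. The multiplicative domain of $\varphi$ is $M_\varphi=\{a\in A:\varphi(ab)=\varphi(a)\varphi(b)\text{ and }\varphi(ba)=\varphi(b)\varphi(a)\text{ for all }b\in A\}$. The $\varphi$-module domain of $\Phi$ is $X_\Phi=\{x\in X:\Phi(xb)=\Phi(x)\varphi(b)\text{ for all }b\in A\}$. *)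

theory Defs
  imports "HOL-Analysis.Analysis"
begin

class scaleC =
  fixes scaleC :: "complex \<Rightarrow> 'a \<Rightarrow> 'a"  (infixr \<open>*\<^sub>C\<close> 75)

class complex_vector = real_vector + scaleC +
  assumes scaleC_add_right: "c *\<^sub>C (x + y) = c *\<^sub>C x + c *\<^sub>C y"
    and scaleC_add_left: "(c + d) *\<^sub>C x = c *\<^sub>C x + d *\<^sub>C x"
    and scaleC_scaleC: "c *\<^sub>C d *\<^sub>C x = (c * d) *\<^sub>C x"
    and scaleC_of_real: "complex_of_real r *\<^sub>C x = r *\<^sub>R x"

class complex_normed_vector = complex_vector + real_normed_vector +
  assumes norm_scaleC: "norm (c *\<^sub>C x) = cmod c * norm x"

definition clinear :: "('a::complex_vector \<Rightarrow> 'b::complex_vector) \<Rightarrow> bool" where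
  "clinear f \<longleftrightarrow> (\<forall>x y. f (x + y) = f x + f y) \<and> (\<forall>c x. f (c *\<^sub>C x) = c *\<^sub>C f x)"

text \<open>Hilbert spaces; the inner product is linear in the second variable.\<close>

class complex_hilbert_space = complex_normed_vector + complete_space +
  fixes cinner :: "'a \<Rightarrow> 'a \<Rightarrow> complex"
  assumes cinner_add_right: "cinner x (y + z) = cinner x y + cinner x z"
    and cinner_scaleC_right: "cinner x (c *\<^sub>C y) = c * cinner x y"
    and cinner_commute: "cinner y x = cnj (cinner x y)"
    and cinner_ge_zero: "cinner x x \<in> \<real>\<^sub>\<ge>\<^sub>0"
    and norm_eq_sqrt_cinner: "norm x = sqrt (cmod (cinner x x))"

text \<open>C*-algebras, not necessarily unital.\<close>

class cstar_algebra = complex_normed_vector + real_normed_algebra + complete_space +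
  fixes star :: "'a \<Rightarrow> 'a"  (\<open>_\<^sup>\<star>\<close> [999] 999)
  assumes mult_scaleC_left: "(c *\<^sub>C a) * b = c *\<^sub>C (a * b)"
    and mult_scaleC_right: "a * (c *\<^sub>C b) = c *\<^sub>C (a * b)"
    and star_add: "(a + b)\<^sup>\<star> = a\<^sup>\<star> + b\<^sup>\<star>"
    and star_scaleC: "(c *\<^sub>C a)\<^sup>\<star> = cnj c *\<^sub>C a\<^sup>\<star>"
    and star_mult: "(a * b)\<^sup>\<star> = b\<^sup>\<star> * a\<^sup>\<star>"
    and star_star: "a\<^sup>\<star>\<^sup>\<star> = a"
    and cstar_identity: "norm (a\<^sup>\<star> * a) = (norm a)\<^sup>2"

definition cstar_positive :: "'a::cstar_algebra \<Rightarrow> bool" where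
  "cstar_positive a \<longleftrightarrow> (\<exists>c. a = c\<^sup>\<star> * c)"

text \<open>
  The completeness of a Hilbert module is that of its type, whose norm is required to be the
  one induced by the inner product.
\<close>

locale hilbert_module =
  fixes act :: "'x::{complex_normed_vector, complete_space} \<Rightarrow> 'a::cstar_algebra \<Rightarrow> 'x"
    and ip :: "'x \<Rightarrow> 'x \<Rightarrow> 'a"
  assumes act_add_left: "act (x + y) a = act x a + act y a"
    and act_add_right: "act x (a + b) = act x a + act x b"
    and act_mult: "act x (a * b) = act (act x a) b"
    and act_scaleC_left: "act (c *\<^sub>C x) a = c *\<^sub>C act x a"
    and act_scaleC_right: "act x (c *\<^sub>C a) = c *\<^sub>C act x a"
    and ip_add_right: "ip x (y + z) = ip x y + ip x z"
    and ip_scaleC_right: "ip x (c *\<^sub>C y) = c *\<^sub>C ip x y"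
    and ip_act_right: "ip x (act y a) = ip x y * a"
    and ip_star: "ip y x = (ip x y)\<^sup>\<star>"
    and ip_positive: "cstar_positive (ip x x)"
    and ip_definite: "ip x x = 0 \<Longrightarrow> x = 0"
    and norm_eq_sqrt_ip: "norm x = sqrt (norm (ip x x))"

text \<open>
  The type \<open>'h \<Rightarrow>\<^sub>L 'k\<close> consists of the real-linear bounded operators; \<open>L(H,K)\<close> is its
  subset \<open>bounded_ops\<close>.
\<close>

definition bounded_ops ::
  "('h::complex_normed_vector \<Rightarrow>\<^sub>L 'k::complex_normed_vector) set" where
  "bounded_ops = {T. clinear (blinfun_apply T)}"

lemma bounded_linear_scaleC: "bounded_linear (\<lambda>x::'a::complex_normed_vector. c *\<^sub>C x)"
proof (rule bounded_linear_intro)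
  fix r :: real and x y :: 'a
  show "c *\<^sub>C (x + y) = c *\<^sub>C x + c *\<^sub>C y"
    by (rule scaleC_add_right)
  show "c *\<^sub>C (r *\<^sub>R x) = r *\<^sub>R (c *\<^sub>C x)"
    by (simp add: scaleC_of_real [symmetric] scaleC_scaleC mult.commute)
  show "norm (c *\<^sub>C x) \<le> norm x * cmod c"
    by (simp add: norm_scaleC mult.commute)
qed

instantiation blinfun :: (real_normed_vector, complex_normed_vector) complex_vector
begin

definition scaleC_blinfun :: "complex \<Rightarrow> ('a \<Rightarrow>\<^sub>L 'b) \<Rightarrow> 'a \<Rightarrow>\<^sub>L 'b" where
  "c *\<^sub>C T = Blinfun (\<lambda>x. c *\<^sub>C blinfun_apply T x)"

lemma scaleC_blinfun_apply: "blinfun_apply (c *\<^sub>C T) x = c *\<^sub>C blinfun_apply T x"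
  unfolding scaleC_blinfun_def
  by (simp add: bounded_linear_Blinfun_apply
      bounded_linear_compose [OF bounded_linear_scaleC blinfun.bounded_linear_right])

instance
  by standard
    (auto intro!: blinfun_eqI simp: scaleC_blinfun_apply blinfun.add_left blinfun.scaleR_left
      scaleC_add_right scaleC_add_left scaleC_scaleC scaleC_of_real)

end

definition adj ::
  "('h::complex_hilbert_space \<Rightarrow>\<^sub>L 'k::complex_hilbert_space) \<Rightarrow> 'k \<Rightarrow>\<^sub>L 'h" where
  "adj T = (THE S. \<forall>h k. cinner (blinfun_apply T h) k = cinner h (blinfun_apply S k))"

text \<open>Positivity in \<open>M\<^sub>n(A)\<close>: \<open>M = C\<^sup>\<star>C\<close> for some \<open>C \<in> M\<^sub>n(A)\<close>.\<close>

definition positive_matrix :: "nat \<Rightarrow> (nat \<Rightarrow> nat \<Rightarrow> 'a::cstar_algebra) \<Rightarrow> bool" where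
  "positive_matrix n M \<longleftrightarrow>
     (\<exists>C. \<forall>i<n. \<forall>j<n. M i j = (\<Sum>k<n. (C k i)\<^sup>\<star> * C k j))"

text \<open>Positivity in \<open>M\<^sub>n(L(H)) = L(H\<^sup>n)\<close>: \<open>\<langle>h, Th\<rangle> \<ge> 0\<close> for all \<open>h \<in> H\<^sup>n\<close>.\<close>

definition positive_op_matrix ::
  "nat \<Rightarrow> (nat \<Rightarrow> nat \<Rightarrow> 'h::complex_hilbert_space \<Rightarrow>\<^sub>L 'h) \<Rightarrow> bool" where
  "positive_op_matrix n T \<longleftrightarrow>
     (\<forall>h. (\<Sum>i<n. \<Sum>j<n. cinner (h i) (blinfun_apply (T i j) (h j))) \<in> \<real>\<^sub>\<ge>\<^sub>0)"

definition completely_positive ::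
  "('a::cstar_algebra \<Rightarrow> 'h::complex_hilbert_space \<Rightarrow>\<^sub>L 'h) \<Rightarrow> bool" where
  "completely_positive \<phi> \<longleftrightarrow>
     (\<forall>n M. positive_matrix n M \<longrightarrow> positive_op_matrix n (\<lambda>i j. \<phi> (M i j)))"

definition phi_map ::
  "('x \<Rightarrow> 'x \<Rightarrow> 'a) \<Rightarrow> ('a \<Rightarrow> 'h::complex_hilbert_space \<Rightarrow>\<^sub>L 'h) \<Rightarrow>
   ('x \<Rightarrow> 'h \<Rightarrow>\<^sub>L 'k::complex_hilbert_space) \<Rightarrow> bool" where
  "phi_map ip \<phi> \<Phi> \<longleftrightarrow>
     (\<forall>x. \<Phi> x \<in> bounded_ops) \<and> (\<forall>x y. adj (\<Phi> x) o\<^sub>L \<Phi> y = \<phi> (ip x y))"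

definition multiplicative_domain ::
  "('a::cstar_algebra \<Rightarrow> 'h::complex_hilbert_space \<Rightarrow>\<^sub>L 'h) \<Rightarrow> 'a set" where
  "multiplicative_domain \<phi> =
     {a. \<forall>b. \<phi> (a * b) = \<phi> a o\<^sub>L \<phi> b \<and> \<phi> (b * a) = \<phi> b o\<^sub>L \<phi> a}"

definition module_domain ::
  "('x \<Rightarrow> 'a \<Rightarrow> 'x) \<Rightarrow> ('a \<Rightarrow> 'h::complex_hilbert_space \<Rightarrow>\<^sub>L 'h) \<Rightarrow>
   ('x \<Rightarrow> 'h \<Rightarrow>\<^sub>L 'k::complex_hilbert_space) \<Rightarrow> 'x set" where
  "module_domain act \<phi> \<Phi> = {x. \<forall>b. \<Phi> (act x b) = \<Phi> x o\<^sub>L \<phi> b}"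

end

theory Submission imports Defs begin

text \<open>
  Write \<open>p = \<langle>x\<^sub>0, x\<^sub>0\<rangle>\<close>. The identity \<open>\<Phi>(x)\<^sup>\<star> \<Phi>(y) = \<phi>(\<langle>x, y\<rangle>)\<close> turns statements
  about \<open>\<Phi>\<close> into statements about \<open>\<phi>\<close>. If \<open>\<Phi>(x\<^sub>0 b) = \<Phi>(x\<^sub>0) \<phi>(b)\<close> for all \<open>b\<close>, then
  inserting this in \<open>\<phi>(p b) = \<Phi>(x\<^sub>0)\<^sup>\<star> \<Phi>(x\<^sub>0 b)\<close>, in
  \<open>\<phi>(b p) = \<Phi>(x\<^sub>0 b\<^sup>\<star>)\<^sup>\<star> \<Phi>(x\<^sub>0)\<close> and in
  \<open>\<phi>(b\<^sup>\<star> p b) = \<Phi>(x\<^sub>0 b)\<^sup>\<star> \<Phi>(x\<^sub>0 b)\<close> gives the three multiplicativity properties.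
  Conversely, those properties make all four terms of
  \<open>\<parallel>\<Phi>(x\<^sub>0 b) h - \<Phi>(x\<^sub>0) \<phi>(b) h\<parallel>\<^sup>2\<close> equal up to sign, so that they cancel.

  Both directions use that \<open>\<phi>\<close> is Hermitian, \<open>\<phi>(b)\<^sup>\<star> = \<phi>(b\<^sup>\<star>)\<close>
  (\<open>completely_positive_hermitian\<close>), and this is where the work lies. Complete positivity
  gives it directly when \<open>b\<close> is a product of two elements
  (\<open>completely_positive_hermitian_product\<close>). In an algebra without unit it remains to see that
  products span (\<open>cstar_product_induct\<close>). This can be done without spectral theory: for a small
  self-adjoint \<open>a\<close> the Cayley transform \<open>u\<close> of \<open>a\<close> is unitary, the binomial series of
  \<open>sqrt (1 - t)\<close> converges absolutely at \<open>t = u\<close>, so \<open>1 - u\<close> is the square of an element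
  of the algebra (\<open>exists_square_root\<close>), and \<open>a\<close> differs from a multiple of \<open>1 - u\<close> by a
  product.

  The existence of adjoints of bounded operators (\<open>cinner_adj\<close>) comes from the Riesz
  representation theorem.
\<close>

section \<open>Complex vector spaces and C*-algebras\<close>

lemma scaleR_conv_scaleC: "r *\<^sub>R a = complex_of_real r *\<^sub>C (a::'a::complex_vector)"
  by (simp add: scaleC_of_real)

lemma scaleC_1 [simp]: "1 *\<^sub>C a = (a::'a::complex_vector)"
  using scaleC_of_real [of 1 a] by simp

lemma scaleC_minus1 [simp]: "(-1) *\<^sub>C a = - (a::'a::complex_vector)"
  using scaleC_of_real [of "-1" a] by simp

lemma scaleC_minus_right [simp]: "c *\<^sub>C (- a) = - (c *\<^sub>C (a::'a::complex_vector))"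
  by (metis scaleC_minus1 scaleC_scaleC mult.commute)

lemma scaleC_minus_left [simp]: "(- c) *\<^sub>C a = - (c *\<^sub>C (a::'a::complex_vector))"
  by (metis scaleC_minus1 scaleC_scaleC mult_minus1)

lemma scaleC_diff_right: "c *\<^sub>C (a - b) = c *\<^sub>C a - c *\<^sub>C (b::'a::complex_vector)"
  using scaleC_add_right [of c a "- b"] by simp

instance cstar_algebra \<subseteq> banach ..

lemma norm_star [simp]: "norm (a\<^sup>\<star>) = norm (a::'a::cstar_algebra)"
proof -
  have le: "norm b \<le> norm (b\<^sup>\<star>)" for b :: 'a
  proof (cases "b = 0")
    case False
    have "norm b * norm b \<le> norm (b\<^sup>\<star>) * norm b"
      using norm_mult_ineq [of "b\<^sup>\<star>" b] by (simp add: cstar_identity power2_eq_square)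
    then show ?thesis using False by simp
  qed simp
  show ?thesis using le [of a] le [of "a\<^sup>\<star>"] by (simp add: star_star)
qed

lemma star_minus: "(- a)\<^sup>\<star> = - (a::'a::cstar_algebra)\<^sup>\<star>"
  using star_scaleC [of "-1" a] by simp

lemma star_diff: "(a - b)\<^sup>\<star> = a\<^sup>\<star> - (b::'a::cstar_algebra)\<^sup>\<star>"
  using star_add [of a "- b"] by (simp add: star_minus)

lemma star_scaleR: "(r *\<^sub>R a)\<^sup>\<star> = r *\<^sub>R (a::'a::cstar_algebra)\<^sup>\<star>"
  by (simp add: scaleR_conv_scaleC star_scaleC)

lemma eq_zero_if_right_annihilates:
  fixes a :: "'a::cstar_algebra"
  assumes "\<And>x. a * x = 0"
  shows "a = 0"
proof -
  have "norm (a\<^sup>\<star>\<^sup>\<star> * a\<^sup>\<star>) = 0" using assms by (simp add: star_star)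
  then show ?thesis by (simp add: cstar_identity)
qed

section \<open>The binomial series of the square root\<close>

text \<open>
  The coefficients of the binomial series of \<open>sqrt (1 - t)\<close>. This series still converges
  absolutely at \<open>t = 1\<close>, with value 0, and this is why it may be applied to contractions
  of norm exactly 1.
\<close>

definition sqrt_coeff :: "nat \<Rightarrow> real" where
  "sqrt_coeff k = (- 1) ^ k * (1/2 gchoose k)"

lemma sqrt_coeff_0 [simp]: "sqrt_coeff 0 = 1"
  by (simp add: sqrt_coeff_def)

lemma sqrt_coeff_Suc: "sqrt_coeff (Suc k) = sqrt_coeff k * (real k - 1/2) / real (Suc k)"
proof -
  have "real (Suc k) * (1/2 gchoose Suc k :: real) = (1/2 - real k) * (1/2 gchoose k)"
    using gbinomial_mult_1 [of "1/2::real" k] by (simp add: algebra_simps)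
  then have "sqrt_coeff (Suc k) * real (Suc k) = sqrt_coeff k * (real k - 1/2)"
    unfolding sqrt_coeff_def power_Suc
    by (metis (no_types, opaque_lifting) minus_diff_eq mult.assoc mult.commute mult_minus_left mult_minus_right mult_1)
  then show ?thesis by (simp add: eq_divide_eq del: of_nat_Suc)
qed

lemma sqrt_coeff_Suc_nonpos: "sqrt_coeff (Suc k) \<le> 0"
proof (induction k)
  case (Suc k)
  then show ?case
    by (subst sqrt_coeff_Suc) (simp add: mult_nonpos_nonneg divide_nonpos_pos)
qed (simp add: sqrt_coeff_Suc)

text \<open>
  Since only the coefficient of index 0 is positive, this bound controls the sum of the
  absolute values.
\<close>

lemma sum_sqrt_coeff_nonneg: "0 \<le> (\<Sum>k\<le>n. sqrt_coeff k)"
proof -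
  have eq: "(\<Sum>k\<le>n. sqrt_coeff k) = (1 - 2 * real n) * sqrt_coeff n" for n
  proof (induction n)
    case (Suc n)
    have "sqrt_coeff (Suc n) * real (Suc n) = sqrt_coeff n * (real n - 1/2)"
      unfolding sqrt_coeff_Suc by (simp del: of_nat_Suc)
    then show ?case by (simp add: Suc.IH algebra_simps)
  qed simp
  show ?thesis
    using sqrt_coeff_Suc_nonpos [of "n - 1"]
    unfolding eq by (cases n) (simp_all add: mult_nonpos_nonpos)
qed

lemma summable_abs_sqrt_coeff: "summable (\<lambda>k. \<bar>sqrt_coeff k\<bar>)"
proof (rule bounded_imp_summable)
  fix n
  have "(\<Sum>k\<le>n. \<bar>sqrt_coeff k\<bar>) = 2 - (\<Sum>k\<le>n. sqrt_coeff k)"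
    by (induction n) (simp_all add: sqrt_coeff_Suc_nonpos)
  then show "(\<Sum>k\<le>n. \<bar>sqrt_coeff k\<bar>) \<le> 2"
    using sum_sqrt_coeff_nonneg [of n] by linarith
qed simp

text \<open>Coefficientwise, this is \<open>sqrt (1 - t) * sqrt (1 - t) = 1 - t\<close>.\<close>

lemma sqrt_coeff_convolution:
  "(\<Sum>i\<le>n. sqrt_coeff i * sqrt_coeff (n - i)) = (if n = 0 then 1 else if n = 1 then - 1 else 0)"
proof -
  have "(\<Sum>i\<le>n. sqrt_coeff i * sqrt_coeff (n - i))
      = (- 1) ^ n * (\<Sum>i\<le>n. (1/2 gchoose i) * (1/2 gchoose (n - i)))"
    unfolding sum_distrib_left
  proof (rule sum.cong)
    fix i assume "i \<in> {..n}"
    then have "(- 1) ^ n = (- 1) ^ i * (- 1 :: real) ^ (n - i)"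
      by (simp flip: power_add)
    then show "sqrt_coeff i * sqrt_coeff (n - i)
        = (- 1) ^ n * ((1/2 gchoose i) * (1/2 gchoose (n - i)))"
      by (simp add: sqrt_coeff_def mult_ac)
  qed simp
  also have "\<dots> = (- 1) ^ n * (1 gchoose n)"
    using gbinomial_Vandermonde [of "1/2::real" "1/2" n] by (simp add: atMost_atLeast0)
  also have "\<dots> = (- 1) ^ n * real (1 choose n)"
    using binomial_gbinomial [of 1 n, where ?'a = real] by simp
  finally show ?thesis by (auto simp: binomial_eq_0)
qed

lemma suminf_sqrt_coeff: "(\<Sum>k. sqrt_coeff k) = 0"
proof -
  have "(\<lambda>n. \<Sum>i\<le>n. sqrt_coeff i * sqrt_coeff (n - i)) sums
      ((\<Sum>k. sqrt_coeff k) * (\<Sum>k. sqrt_coeff k))"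
    using summable_abs_sqrt_coeff by (intro Cauchy_product_sums) simp_all
  moreover have "(\<lambda>n. \<Sum>i\<le>n. sqrt_coeff i * sqrt_coeff (n - i)) sums 0"
    using sums_finite [of "{0, 1}" "\<lambda>n. \<Sum>i\<le>n. sqrt_coeff i * sqrt_coeff (n - i)"]
    by (simp add: sqrt_coeff_convolution)
  ultimately show ?thesis
    using sums_unique2 by fastforce
qed

section \<open>C*-algebras are spanned by products\<close>

text \<open>
  The algebra need not have a unit. In the unitization \<open>compl_power w k\<close> is
  \<open>1 - (1 - w)\<^sup>k\<close>, an element of the algebra itself.
\<close>

fun compl_power :: "'a::cstar_algebra \<Rightarrow> nat \<Rightarrow> 'a" where
  "compl_power w 0 = 0"
| "compl_power w (Suc k) = w + compl_power w k - w * compl_power w k"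

text \<open>This is the multiplicativity of the powers of \<open>1 - w\<close>.\<close>

lemma compl_power_add:
  "compl_power w (j + k) = compl_power w j + compl_power w k - compl_power w j * compl_power w k"
proof (induction j)
  case (Suc j)
  show ?case by (simp add: Suc.IH) (simp add: algebra_simps)
qed simp

text \<open>
  Left multiplication by \<open>(1 - w)\<^sup>k\<close> is a contraction, so left multiplication by
  \<open>1 - (1 - w)\<^sup>k\<close> has norm at most 2. By the C*-identity an element has the norm of its
  left multiplication operator, which is attained at its adjoint.
\<close>

lemma norm_compl_power_le:
  fixes w :: "'a::cstar_algebra"
  assumes contr: "\<And>x. norm (x - w * x) \<le> norm x"
  shows "norm (compl_power w k) \<le> 2"
proof -
  have power: "norm (x - compl_power w k * x) \<le> norm x" for x
  proof (induction k)
    case (Suc k)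
    have "x - compl_power w (Suc k) * x
        = (x - compl_power w k * x) - w * (x - compl_power w k * x)"
      by (simp add: algebra_simps)
    then show ?case using contr Suc.IH by (metis order_trans)
  qed simp
  define z where "z = compl_power w k"
  have "norm (z * x) \<le> 2 * norm x" for x
    using power [of x] norm_triangle_ineq4 [of x "x - z * x"] by (simp add: z_def)
  from this [of "z\<^sup>\<star>"] have "norm z * norm z \<le> 2 * norm z"
    using cstar_identity [of "z\<^sup>\<star>"] by (simp add: star_star power2_eq_square)
  then show ?thesis
    unfolding z_def [symmetric] by (cases "z = 0") simp_all
qed

text \<open>
  The root is \<open>sqrt (1 - (1 - w))\<close>, given by the binomial series at the contraction
  \<open>1 - w\<close>. As the coefficients sum to 0, the series can be rewritten in terms of the elements
  \<open>1 - (1 - w)\<^sup>k\<close> without leaving the algebra; up to sign it is the sum \<open>s\<close> below.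
\<close>

lemma exists_square_root:
  fixes w :: "'a::cstar_algebra"
  assumes contr: "\<And>x. norm (x - w * x) \<le> norm x"
  shows "\<exists>s. w = s * s"
proof -
  let ?c = sqrt_coeff and ?z = "compl_power w"
  have abs_summable_scaled: "summable (\<lambda>k. norm (?c k *\<^sub>R v k))" if "\<And>k. norm (v k) \<le> B" for v :: "nat \<Rightarrow> 'a" and B
  proof (rule summable_comparison_test)
    show "\<exists>N. \<forall>n\<ge>N. norm (norm (?c n *\<^sub>R v n)) \<le> \<bar>?c n\<bar> * B"
      using that by (auto intro!: mult_left_mono)
    show "summable (\<lambda>n. \<bar>?c n\<bar> * B)"
      by (intro summable_mult2 summable_abs_sqrt_coeff)
  qed
  have bound: "norm (?z k) \<le> 2" for k
    using contr by (rule norm_compl_power_le)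
  define s where "s = (\<Sum>k. ?c k *\<^sub>R ?z k)"
  note summable_s = abs_summable_scaled [of ?z, OF bound]
  \<comment> \<open>Multiplying by \<open>x\<close> turns the scalar series, whose sum is 0, into a series in the
    algebra, to which the Cauchy product applies.\<close>
  have "(w - s * s) * x = 0" for x
  proof -
    have zx: "norm (?z k * x) \<le> 2 * norm x" for k
      using norm_mult_ineq [of "?z k" x] mult_right_mono [OF bound norm_ge_zero, of k x] by linarith
    have suminf_x: "(\<Sum>k. ?c k *\<^sub>R x) = 0"
      using suminf_scaleR_left [of ?c x] summable_abs_sqrt_coeff
      by (simp add: suminf_sqrt_coeff summable_rabs_cancel)
    have suminf_sx: "(\<Sum>k. ?c k *\<^sub>R (?z k * x)) = s * x"
      using suminf_mult2 [OF summable_norm_cancel [OF summable_s], of x] by (simp add: s_def)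
    have "(\<lambda>n. \<Sum>i\<le>n. (?c i *\<^sub>R ?z i) * (?c (n - i) *\<^sub>R (?z (n - i) * x)))
        sums (s * (s * x))"
      using Cauchy_product_sums [OF summable_s abs_summable_scaled [of "\<lambda>k. ?z k * x", OF zx]]
      by (simp only: suminf_sx s_def)
    then have "(\<lambda>n. \<Sum>i\<le>n. (?c i * ?c (n - i)) *\<^sub>R (?z i * ?z (n - i) * x)) sums (s * s * x)"
      by (simp add: mult.assoc) (simp add: mult.commute)
    moreover
    have left: "(\<lambda>n. \<Sum>i\<le>n. (?c i * ?c (n - i)) *\<^sub>R (?z i * x)) sums 0"
      using Cauchy_product_sums [OF summable_s abs_summable_scaled [of "\<lambda>k. x", OF order_refl]]
      by (simp add: suminf_x) (simp add: mult.commute)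
    moreover have "(\<lambda>n. \<Sum>i\<le>n. (?c i * ?c (n - i)) *\<^sub>R (?z (n - i) * x)) sums 0"
    proof -
      have "(\<Sum>i\<le>n. (?c i * ?c (n - i)) *\<^sub>R (?z (n - i) * x))
          = (\<Sum>i\<le>n. (?c i * ?c (n - i)) *\<^sub>R (?z i * x))" for n
        by (rule sum.reindex_bij_witness [of _ "\<lambda>i. n - i" "\<lambda>i. n - i"]) (auto simp: mult.commute)
      with left show ?thesis by simp
    qed
    \<comment> \<open>By additivity of exponents the three convolutions combine to that of the coefficients,
      which vanishes beyond index 1.\<close>
    ultimately have "(\<lambda>n. (\<Sum>i\<le>n. (?c i * ?c (n - i)) *\<^sub>R (?z i * x))
         + (\<Sum>i\<le>n. (?c i * ?c (n - i)) *\<^sub>R (?z (n - i) * x))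
         - (\<Sum>i\<le>n. (?c i * ?c (n - i)) *\<^sub>R (?z i * ?z (n - i) * x))) sums (0 + 0 - s * s * x)"
      by (intro sums_add sums_diff)
    moreover have "(\<Sum>i\<le>n. (?c i * ?c (n - i)) *\<^sub>R (?z i * x))
         + (\<Sum>i\<le>n. (?c i * ?c (n - i)) *\<^sub>R (?z (n - i) * x))
         - (\<Sum>i\<le>n. (?c i * ?c (n - i)) *\<^sub>R (?z i * ?z (n - i) * x))
         = (\<Sum>i\<le>n. ?c i * ?c (n - i)) *\<^sub>R (?z n * x)" for n
    proof -
      have "?z n = ?z i + ?z (n - i) - ?z i * ?z (n - i)" if "i \<le> n" for i
        using compl_power_add [of w i "n - i"] that by simp
      then have "(?c i * ?c (n - i)) *\<^sub>R (?z i * x) + (?c i * ?c (n - i)) *\<^sub>R (?z (n - i) * x)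
          - (?c i * ?c (n - i)) *\<^sub>R (?z i * ?z (n - i) * x)
          = (?c i * ?c (n - i)) *\<^sub>R (?z n * x)" if "i \<le> n" for i
        using that
        by (simp add: distrib_right left_diff_distrib scaleR_add_right scaleR_diff_right)
      then show ?thesis
        unfolding scaleR_sum_left sum.distrib [symmetric] sum_subtractf [symmetric]
        by (intro sum.cong) simp_all
    qed
    ultimately have "(\<lambda>n. (\<Sum>i\<le>n. ?c i * ?c (n - i)) *\<^sub>R (?z n * x)) sums (- (s * s * x))"
      by simp
    moreover have "(\<lambda>n. (\<Sum>i\<le>n. ?c i * ?c (n - i)) *\<^sub>R (?z n * x)) sums (- (w * x))"
      using sums_finite [of "{0, 1}" "\<lambda>n. (\<Sum>i\<le>n. ?c i * ?c (n - i)) *\<^sub>R (?z n * x)"]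
      by (simp add: sqrt_coeff_convolution)
    ultimately show ?thesis
      using sums_unique2 by (fastforce simp: left_diff_distrib)
  qed
  then have "w - s * s = 0" by (rule eq_zero_if_right_annihilates)
  then show ?thesis by auto
qed

text \<open>
  In the unitization \<open>1 + 2 y\<close> is the Cayley transform \<open>(1 + \<i>a) (1 - \<i>a)\<^sup>-\<^sup>1\<close>, with
  \<open>y = \<i>a + (\<i>a)\<^sup>2 + \<dots>\<close>. It is unitary because \<open>a\<close> is self-adjoint, and so it acts
  isometrically.
\<close>

lemma selfadjoint_cayley:
  fixes a :: "'a::cstar_algebra"
  assumes sa: "a\<^sup>\<star> = a" and small: "norm a \<le> 1/2"
  shows "\<exists>y. y = \<i> *\<^sub>C a + \<i> *\<^sub>C (a * y) \<and> (\<forall>x. norm (x + 2 *\<^sub>R (y * x)) = norm x)"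
proof -
  define f where "f y = \<i> *\<^sub>C a + \<i> *\<^sub>C (a * y)" for y
  have "dist (f x) (f y) \<le> 1/2 * dist x y" for x y
  proof -
    have "f x - f y = \<i> *\<^sub>C (a * (x - y))"
      using scaleC_add_right [of \<i> "a * x" "- (a * y)"] by (simp add: f_def right_diff_distrib)
    then have "dist (f x) (f y) \<le> norm a * norm (x - y)"
      by (simp add: dist_norm norm_scaleC norm_mult_ineq)
    also have "\<dots> \<le> 1/2 * dist x y"
      unfolding dist_norm by (rule mult_right_mono [OF small norm_ge_zero])
    finally show ?thesis .
  qed
  then obtain y where "f y = y"
    using banach_fix_type [of "1/2" f] by auto
  then have y: "y = \<i> *\<^sub>C a + \<i> *\<^sub>C (a * y)" by (simp add: f_def)
  have y_star: "y\<^sup>\<star> = - (\<i> *\<^sub>C a) - \<i> *\<^sub>C (y\<^sup>\<star> * a)"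
    by (subst y) (simp add: star_add star_scaleC star_mult sa)
  have "y\<^sup>\<star> * y = \<i> *\<^sub>C (y\<^sup>\<star> * a) + \<i> *\<^sub>C (y\<^sup>\<star> * a * y)"
    by (subst (2) y) (simp add: distrib_left mult_scaleC_right mult.assoc)
  moreover have "y\<^sup>\<star> * y = - (\<i> *\<^sub>C (a * y)) - \<i> *\<^sub>C (y\<^sup>\<star> * a * y)"
    by (subst y_star) (simp add: left_diff_distrib mult_scaleC_left)
  moreover have "\<i> *\<^sub>C (y\<^sup>\<star> * a) = - (\<i> *\<^sub>C a) - y\<^sup>\<star>"
    using y_star by (simp add: algebra_simps)
  moreover have "\<i> *\<^sub>C (a * y) = y - \<i> *\<^sub>C a"
    using y by (simp add: algebra_simps)
  ultimately have "y\<^sup>\<star> * y + y\<^sup>\<star> * y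
      = (- (\<i> *\<^sub>C a) - y\<^sup>\<star> + \<i> *\<^sub>C (y\<^sup>\<star> * a * y)) + (- (y - \<i> *\<^sub>C a) - \<i> *\<^sub>C (y\<^sup>\<star> * a * y))"
    by metis
  then have unitary: "y + y\<^sup>\<star> + 2 *\<^sub>R (y\<^sup>\<star> * y) = 0"
    by (simp add: scaleR_2)
  have "norm (x + 2 *\<^sub>R (y * x)) = norm x" for x
  proof -
    have "(x + 2 *\<^sub>R (y * x))\<^sup>\<star> * (x + 2 *\<^sub>R (y * x))
        = x\<^sup>\<star> * x + 2 *\<^sub>R (x\<^sup>\<star> * (y + y\<^sup>\<star> + 2 *\<^sub>R (y\<^sup>\<star> * y)) * x)"
      by (simp add: star_add star_scaleR star_mult algebra_simps)
    then have "(norm (x + 2 *\<^sub>R (y * x)))\<^sup>2 = (norm x)\<^sup>2"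
      by (simp add: unitary flip: cstar_identity)
    then show ?thesis by simp
  qed
  with y show ?thesis by blast
qed

text \<open>
  Every element is a linear combination of products of two elements. It suffices to treat a
  small self-adjoint \<open>b\<close>. Its Cayley transform \<open>1 + 2 y\<close> is unitary, hence \<open>- 2 y\<close> is a
  square, and \<open>\<i>b = y - \<i>by\<close> expresses \<open>b\<close> through this square and a product.
\<close>

lemma cstar_product_induct [case_names add scaleC mult]:
  fixes a :: "'a::cstar_algebra"
  assumes add: "\<And>x y. P x \<Longrightarrow> P y \<Longrightarrow> P (x + y)"
    and scaleC: "\<And>c x. P x \<Longrightarrow> P (c *\<^sub>C x)"
    and mult: "\<And>x y. P (x * y)"
  shows "P a"
proof -
  have small: "P b" if sa: "b\<^sup>\<star> = b" and le: "norm b \<le> 1/2" for b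
  proof -
    obtain y where y: "y = \<i> *\<^sub>C b + \<i> *\<^sub>C (b * y)" and iso: "\<And>x. norm (x + 2 *\<^sub>R (y * x)) = norm x"
      using selfadjoint_cayley [OF sa le] by blast
    obtain s where "(-2) *\<^sub>R y = s * s"
      using exists_square_root [of "(-2) *\<^sub>R y"] iso by auto
    then have "y = (-1/2) *\<^sub>R (s * s)"
      by (simp flip: \<open>(-2) *\<^sub>R y = s * s\<close>)
    then have "P y" by (metis scaleR_conv_scaleC scaleC mult)
    have "\<i> *\<^sub>C b = y + (- \<i>) *\<^sub>C (b * y)"
      using y by (simp add: algebra_simps)
    then have "P (\<i> *\<^sub>C b)" using \<open>P y\<close> add scaleC mult by metis
    then have "P ((- \<i>) *\<^sub>C \<i> *\<^sub>C b)" by (rule scaleC)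
    then show "P b" by (simp add: scaleC_scaleC)
  qed
  have selfadjoint: "P b" if sa: "b\<^sup>\<star> = b" for b
  proof (cases "b = 0")
    case True
    then show ?thesis using mult [of 0 0] by simp
  next
    case False
    have "P ((1 / (2 * norm b)) *\<^sub>R b)"
      by (rule small) (use False in \<open>simp_all add: star_scaleR sa\<close>)
    then have "P (complex_of_real (2 * norm b) *\<^sub>C (1 / (2 * norm b)) *\<^sub>R b)"
      by (rule scaleC)
    then show ?thesis using False by (simp only: scaleC_of_real) simp
  qed
  have "P (a + a\<^sup>\<star>)" "P (\<i> *\<^sub>C (a\<^sup>\<star> - a))"
    by (auto intro!: selfadjoint
      simp: star_add star_scaleC star_star star_minus star_diff scaleC_diff_right)
  then have "P ((1/2) *\<^sub>C (a + a\<^sup>\<star>) + (\<i> / 2) *\<^sub>C (\<i> *\<^sub>C (a\<^sup>\<star> - a)))"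
    by (rule add [OF scaleC scaleC])
  also have "(1/2) *\<^sub>C (a + a\<^sup>\<star>) + (\<i> / 2) *\<^sub>C (\<i> *\<^sub>C (a\<^sup>\<star> - a)) = a"
  proof -
    have "(1/2) *\<^sub>C a + (1/2) *\<^sub>C a = a"
      by (simp flip: scaleC_add_left)
    then show ?thesis
      by (simp add: scaleC_add_right scaleC_diff_right scaleC_scaleC)
  qed
  finally show ?thesis .
qed

section \<open>Riesz representation and adjoints\<close>

lemma cinner_add_left: "cinner (x + y) z = cinner x z + cinner y (z::'a::complex_hilbert_space)"
  by (metis cinner_commute cinner_add_right complex_cnj_add)

lemma cinner_scaleC_left: "cinner (c *\<^sub>C x) (y::'a::complex_hilbert_space) = cnj c * cinner x y"
  by (metis cinner_commute cinner_scaleC_right complex_cnj_mult)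

lemma cinner_scaleR_right: "cinner x (r *\<^sub>R y) = complex_of_real r * cinner x (y::'a::complex_hilbert_space)"
  by (simp add: scaleR_conv_scaleC cinner_scaleC_right)

lemma cinner_zero_right [simp]: "cinner x (0::'a::complex_hilbert_space) = 0"
  using cinner_add_right [of x 0 0] by simp

lemma cinner_zero_left [simp]: "cinner (0::'a::complex_hilbert_space) x = 0"
  using cinner_add_left [of 0 0 x] by simp

lemma cinner_diff_right: "cinner x (y - z) = cinner x y - cinner x (z::'a::complex_hilbert_space)"
  using cinner_add_right [of x "y - z" z] by simp

lemma cinner_diff_left: "cinner (x - y) z = cinner x z - cinner y (z::'a::complex_hilbert_space)"
  using cinner_add_left [of "x - y" y z] by simp

lemma cinner_self: "cinner x x = complex_of_real ((norm (x::'a::complex_hilbert_space))\<^sup>2)"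
proof -
  obtain r where r: "cinner x x = complex_of_real r" "r \<ge> 0"
    using cinner_ge_zero [of x] by (auto elim: nonneg_Reals_cases)
  then show ?thesis by (simp add: norm_eq_sqrt_cinner)
qed

lemma cinner_ext_right:
  fixes u v :: "'a::complex_hilbert_space"
  assumes "\<And>h. cinner h u = cinner h v"
  shows "u = v"
proof -
  have "cinner (u - v) (u - v) = 0" using assms by (simp add: cinner_diff_right)
  then show ?thesis by (simp add: cinner_self)
qed

lemma norm_add_squared:
  "(norm (x + y))\<^sup>2 = (norm x)\<^sup>2 + (norm y)\<^sup>2 + 2 * Re (cinner x (y::'a::complex_hilbert_space))"
proof -
  have "complex_of_real ((norm (x + y))\<^sup>2) = cinner x x + cinner y y + (cinner x y + cnj (cinner x y))"
    unfolding cinner_self [symmetric]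
    by (simp add: cinner_add_left cinner_add_right cinner_commute [of y x])
  then have "Re (complex_of_real ((norm (x + y))\<^sup>2))
      = Re (cinner x x + cinner y y + (cinner x y + cnj (cinner x y)))" by simp
  then show ?thesis by (simp add: cinner_self)
qed

lemma parallelogram:
  "(norm (x + y))\<^sup>2 + (norm (x - y))\<^sup>2 = 2 * (norm x)\<^sup>2 + 2 * (norm (y::'a::complex_hilbert_space))\<^sup>2"
  using norm_add_squared [of x y] norm_add_squared [of x "- y"] cinner_diff_right [of x 0 y]
  by simp

lemma cinner_Cauchy_Schwarz: "cmod (cinner x y) \<le> norm x * norm (y::'a::complex_hilbert_space)"
proof -
  have Re_le: "Re (cinner x y) \<le> norm x * norm y" for x y :: 'a
  proof -
    have "(norm (x + y))\<^sup>2 \<le> (norm x + norm y)\<^sup>2"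
      by (intro power_mono norm_triangle_ineq norm_ge_zero)
    then show ?thesis by (simp add: norm_add_squared power2_sum)
  qed
  define c where "c = cnj (sgn (cinner x y))"
  have "cmod c \<le> 1" by (simp add: c_def norm_sgn)
  have "c * cinner x y = complex_of_real (cmod (cinner x y))"
    by (simp add: c_def sgn_eq complex_norm_square [symmetric] power2_eq_square mult.commute)
  then have "cmod (cinner x y) = Re (cinner x (c *\<^sub>C y))"
    by (simp add: cinner_scaleC_right)
  also have "\<dots> \<le> norm x * norm (c *\<^sub>C y)" by (rule Re_le)
  also have "\<dots> \<le> norm x * norm y"
    using \<open>cmod c \<le> 1\<close> by (simp add: norm_scaleC mult_left_mono mult_left_le_one_le)
  finally show ?thesis .
qed

text \<open>
  The representing vector is the minimizer of \<open>\<parallel>x\<parallel>\<^sup>2 - 2 g(x)\<close>. By the parallelogram law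
  minimizing sequences are Cauchy, and the vanishing of the first variation at the minimizer is
  the claim.
\<close>

lemma real_riesz:
  fixes g :: "'a::complex_hilbert_space \<Rightarrow> real"
  assumes "bounded_linear g"
  shows "\<exists>y. \<forall>h. g h = Re (cinner y h)"
proof -
  interpret g: bounded_linear g by fact
  define J where "J x = (norm x)\<^sup>2 - 2 * g x" for x
  obtain K where K: "\<And>x. norm (g x) \<le> norm x * K" using g.bounded by blast
  have below: "- K\<^sup>2 \<le> J x" for x
    using K [of x] zero_le_power2 [of "norm x - K"]
    by (simp add: J_def power2_diff)
  define m where "m = (INF x. J x)"
  have bdd: "bdd_below (range J)" by (rule bdd_belowI2) (rule below)
  have m_le: "m \<le> J x" for x unfolding m_def using bdd by (simp add: cINF_lower)
  have "\<exists>x. J x < m + 1 / real (Suc n)" for n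
    using cINF_less_iff [of UNIV J "m + 1 / real (Suc n)"] bdd by (simp add: m_def)
  then obtain X where X: "\<And>n. J (X n) < m + 1 / real (Suc n)" by metis
  have dist_sq: "(norm (x - y))\<^sup>2 \<le> 2 * (J x - m) + 2 * (J y - m)" for x y
  proof -
    have "J ((1/2) *\<^sub>R (x + y)) = (norm (x + y))\<^sup>2 / 4 - (g x + g y)"
      by (simp add: J_def g.scaleR g.add power_divide add_divide_distrib)
    then have "4 * m \<le> (norm (x + y))\<^sup>2 - 4 * (g x + g y)"
      using m_le [of "(1/2) *\<^sub>R (x + y)"] by simp
    then show ?thesis using parallelogram [of x y] by (simp add: J_def)
  qed
  have "Cauchy X"
  proof (rule metric_CauchyI)
    fix e :: real assume "e > 0"
    then obtain N where N: "1 / real (Suc N) < e\<^sup>2 / 4"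
      using nat_approx_posE [of "e\<^sup>2 / 4"] by auto
    have "dist (X i) (X j) < e" if "i \<ge> N" "j \<ge> N" for i j
    proof -
      have close: "J (X k) < m + e\<^sup>2 / 4" if "k \<ge> N" for k
      proof -
        have "J (X k) < m + 1 / real (Suc k)" by (rule X)
        also have "\<dots> \<le> m + 1 / real (Suc N)" using that by (simp add: frac_le)
        also have "\<dots> < m + e\<^sup>2 / 4" using N by simp
        finally show ?thesis .
      qed
      have "(dist (X i) (X j))\<^sup>2 < e\<^sup>2"
        using dist_sq [of "X i" "X j"] close [OF \<open>i \<ge> N\<close>] close [OF \<open>j \<ge> N\<close>]
        unfolding dist_norm by argo
      then show ?thesis using \<open>e > 0\<close> by (simp add: power_less_imp_less_base)
    qed
    then show "\<exists>N. \<forall>i\<ge>N. \<forall>j\<ge>N. dist (X i) (X j) < e" by blast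
  qed
  then obtain y where y: "X \<longlonglongrightarrow> y" by (auto simp: Cauchy_convergent_iff convergent_def)
  have "(\<lambda>n. J (X n)) \<longlonglongrightarrow> J y"
    unfolding J_def by (intro tendsto_intros y g.tendsto)
  moreover have "(\<lambda>n. m + 1 / real (Suc n)) \<longlonglongrightarrow> m + 0"
    by (intro tendsto_intros LIMSEQ_Suc [OF lim_1_over_n])
  ultimately have "J y \<le> m + 0"
    by (rule LIMSEQ_le) (use X in \<open>auto intro: less_imp_le\<close>)
  then have min: "J y \<le> J x" for x using m_le [of x] by simp
  have "g h = Re (cinner y h)" for h
  proof (rule ccontr)
    assume ne: "g h \<noteq> Re (cinner y h)"
    define d where "d = g h - Re (cinner y h)"
    have ineq: "2 * t * d \<le> t\<^sup>2 * (norm h)\<^sup>2" for t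
      using min [of "y + t *\<^sub>R h"]
      by (simp add: J_def g.add g.scaleR norm_add_squared cinner_scaleR_right power_mult_distrib
          d_def algebra_simps)
    have "d \<noteq> 0" using ne by (simp add: d_def)
    show False
    proof (cases "h = 0")
      case True
      then show False using ne g.zero by simp
    next
      case False
      have "2 * d\<^sup>2 / (norm h)\<^sup>2 \<le> d\<^sup>2 / (norm h)\<^sup>2"
        \<comment> \<open>This \<open>t\<close> minimizes \<open>t\<^sup>2 \<parallel>h\<parallel>\<^sup>2 - 2 t d\<close>.\<close>
        using ineq [of "d / (norm h)\<^sup>2"] False
        by (simp add: power2_eq_square field_simps)
      then show False using \<open>d \<noteq> 0\<close> False by (simp add: divide_le_cancel)
    qed
  qed
  then show ?thesis by blast
qed

lemma complex_riesz:
  fixes f :: "'a::complex_hilbert_space \<Rightarrow> complex"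
  assumes "bounded_linear f" and cl: "\<And>h. f (\<i> *\<^sub>C h) = \<i> * f h"
  shows "\<exists>y. \<forall>h. f h = cinner y h"
proof -
  have "bounded_linear (\<lambda>h. Re (f h))"
    using bounded_linear_compose [OF bounded_linear_Re assms(1)] .
  then obtain y where y: "\<And>h. Re (f h) = Re (cinner y h)"
    using real_riesz by blast
  have "f h = cinner y h" for h
    using y [of h] y [of "\<i> *\<^sub>C h"] by (simp add: cl cinner_scaleC_right complex_eq_iff)
  then show ?thesis by blast
qed

lemma bounded_linear_cinner: "bounded_linear (cinner (x::'a::complex_hilbert_space))"
proof (rule bounded_linear_intro)
  show "norm (cinner x y) \<le> norm y * norm x" for y
    using cinner_Cauchy_Schwarz [of x y] by (simp add: mult.commute)
qed (simp_all add: cinner_add_right cinner_scaleR_right scaleR_conv_of_real)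

text \<open>
  The definite description in \<open>adj\<close> denotes the adjoint only once existence is known, which
  is the Riesz representation of the functionals \<open>h \<mapsto> \<langle>k, T h\<rangle>\<close>.
\<close>

lemma cinner_adj:
  fixes T :: "'h::complex_hilbert_space \<Rightarrow>\<^sub>L 'k::complex_hilbert_space"
  assumes "T \<in> bounded_ops"
  shows "cinner (T h) k = cinner h (adj T k)"
proof -
  let ?adjoint = "\<lambda>S. \<forall>h k. cinner (blinfun_apply T h) k = cinner h (blinfun_apply S k)"
  have "\<exists>y. \<forall>h. cinner k (T h) = cinner y h" for k
  proof (rule complex_riesz)
    show "bounded_linear (\<lambda>h. cinner k (T h))"
      by (rule bounded_linear_compose [OF bounded_linear_cinner blinfun.bounded_linear_right])
    show "cinner k (T (\<i> *\<^sub>C h)) = \<i> * cinner k (T h)" for h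
      using assms by (simp add: bounded_ops_def clinear_def cinner_scaleC_right)
  qed
  then obtain S where S: "\<And>k h. cinner k (T h) = cinner (S k) h" by metis
  then have S': "cinner (T h) k = cinner h (S k)" for h k by (metis cinner_commute)
  have "bounded_linear S"
  proof (rule bounded_linear_intro)
    show "S (x + y) = S x + S y" for x y
      by (rule cinner_ext_right) (simp add: cinner_add_right flip: S')
    show "S (r *\<^sub>R x) = r *\<^sub>R S x" for r x
      by (rule cinner_ext_right) (simp add: cinner_scaleR_right flip: S')
    show "norm (S k) \<le> norm k * norm T" for k
    proof -
      have "(norm (S k))\<^sup>2 = cmod (cinner k (T (S k)))"
        by (simp add: S cinner_self norm_power)
      also have "\<dots> \<le> norm k * norm (T (S k))" by (rule cinner_Cauchy_Schwarz)
      also have "\<dots> \<le> norm k * (norm T * norm (S k))"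
        by (intro mult_left_mono norm_blinfun norm_ge_zero)
      finally have "norm (S k) * norm (S k) \<le> (norm k * norm T) * norm (S k)"
        by (simp add: power2_eq_square mult.assoc)
      then show ?thesis by (cases "S k = 0") simp_all
    qed
  qed
  then have ex: "?adjoint (Blinfun S)"
    by (simp add: bounded_linear_Blinfun_apply S')
  have "\<exists>!S. ?adjoint S"
  proof (rule ex1I [where a = "Blinfun S"])
    show "?adjoint (Blinfun S)" by (fact ex)
  next
    fix R assume R: "?adjoint R"
    show "R = Blinfun S"
    proof (rule blinfun_eqI, rule cinner_ext_right)
      show "cinner h (R k) = cinner h (Blinfun S k)" for h k using R ex by metis
    qed
  qed
  from theI' [OF this] show ?thesis unfolding adj_def by blast
qed

section \<open>Completely positive maps are Hermitian\<close>

text \<open>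
  Positivity of the image of the \<open>2 \<times> 2\<close> matrix \<open>(c\<^sub>i\<^sup>\<star> c\<^sub>j)\<close>, where the \<open>c\<^sub>i\<close> are
  \<open>x\<close> and \<open>y\<close>, makes the sum of the off-diagonal terms real. Replacing \<open>k\<close> by \<open>\<i>k\<close>
  separates these terms.
\<close>

lemma completely_positive_hermitian_product:
  fixes \<phi> :: "'a::cstar_algebra \<Rightarrow> 'h::complex_hilbert_space \<Rightarrow>\<^sub>L 'h"
  assumes cp: "completely_positive \<phi>" and bdd: "\<And>a. \<phi> a \<in> bounded_ops"
  shows "cinner (\<phi> (y\<^sup>\<star> * x) h) k = cinner h (\<phi> (x\<^sup>\<star> * y) k)"
proof -
  let ?c = "\<lambda>i::nat. if i = 0 then x else y"
  \<comment> \<open>Factor through the square matrix with first row \<open>(x, y)\<close> and second row 0.\<close>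
  have "positive_matrix 2 (\<lambda>i j. (?c i)\<^sup>\<star> * ?c j)"
    unfolding positive_matrix_def
    by (rule exI [where x = "\<lambda>k i. if k = (0::nat) then ?c i else 0"])
       (simp add: numeral_2_eq_2)
  then have pos: "positive_op_matrix 2 (\<lambda>i j. \<phi> ((?c i)\<^sup>\<star> * ?c j))"
    using cp by (simp add: completely_positive_def)
  have Im_sum: "Im (cinner u (\<phi> (x\<^sup>\<star> * x) u) + cinner u (\<phi> (x\<^sup>\<star> * y) v)
      + (cinner v (\<phi> (y\<^sup>\<star> * x) u) + cinner v (\<phi> (y\<^sup>\<star> * y) v))) = 0" for u v
    using pos [unfolded positive_op_matrix_def, THEN spec, of "\<lambda>i. if i = 0 then u else v"]
    by (simp add: numeral_2_eq_2 complex_nonneg_Reals_iff)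
  have off: "Im (cinner u (\<phi> (x\<^sup>\<star> * y) v)) + Im (cinner v (\<phi> (y\<^sup>\<star> * x) u)) = 0" for u v
    using Im_sum [of u v] Im_sum [of u 0] Im_sum [of 0 v] by (simp add: blinfun.zero_right)
  have "cinner h (\<phi> (x\<^sup>\<star> * y) (\<i> *\<^sub>C k)) = \<i> * cinner h (\<phi> (x\<^sup>\<star> * y) k)"
    using bdd [of "x\<^sup>\<star> * y"] by (simp add: bounded_ops_def clinear_def cinner_scaleC_right)
  then have "cinner h (\<phi> (x\<^sup>\<star> * y) k) = cnj (cinner k (\<phi> (y\<^sup>\<star> * x) h))"
    using off [of h k] off [of h "\<i> *\<^sub>C k"]
    by (simp add: complex_eq_iff cinner_scaleC_left)
  then show ?thesis by (metis cinner_commute)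
qed

text \<open>
  Without a unit, \<open>a\<close> does not appear as \<open>1\<^sup>\<star> a\<close> in the previous lemma; products suffice
  because they span the algebra.
\<close>

lemma completely_positive_hermitian:
  fixes \<phi> :: "'a::cstar_algebra \<Rightarrow> 'h::complex_hilbert_space \<Rightarrow>\<^sub>L 'h"
  assumes cp: "completely_positive \<phi>" and bdd: "\<And>a. \<phi> a \<in> bounded_ops" and lin: "clinear \<phi>"
  shows "cinner (\<phi> a h) k = cinner h (\<phi> (a\<^sup>\<star>) k)"
proof -
  have "\<forall>h k. cinner (\<phi> a h) k = cinner h (\<phi> (a\<^sup>\<star>) k)"
  proof (induction a rule: cstar_product_induct)
    case (add x y)
    then show ?case
      using lin by (simp add: clinear_def star_add blinfun.add_left cinner_add_left cinner_add_right)
  next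
    case (scaleC c x)
    then show ?case
      using lin by (simp add: clinear_def star_scaleC scaleC_blinfun_apply
          cinner_scaleC_left cinner_scaleC_right)
  next
    case (mult x y)
    then show ?case
      using completely_positive_hermitian_product [OF cp bdd, of "x\<^sup>\<star>" y]
      by (simp add: star_mult star_star)
  qed
  then show ?thesis by blast
qed

section \<open>The module domain and the multiplicative domain\<close>

theorem corollary3p8:
  fixes act :: "'x::{complex_normed_vector, complete_space} \<Rightarrow> 'a::cstar_algebra \<Rightarrow> 'x"
    and ip :: "'x \<Rightarrow> 'x \<Rightarrow> 'a"
    and \<phi> :: "'a \<Rightarrow> 'h::complex_hilbert_space \<Rightarrow>\<^sub>L 'h"
    and \<Phi> :: "'x \<Rightarrow> 'h \<Rightarrow>\<^sub>L 'k::complex_hilbert_space"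
    and x\<^sub>0 :: 'x
  assumes "hilbert_module act ip"
    and "\<And>a. \<phi> a \<in> bounded_ops"
    and "clinear \<phi>"
    and "completely_positive \<phi>"
    and "phi_map ip \<phi> \<Phi>"
  shows "x\<^sub>0 \<in> module_domain act \<phi> \<Phi> \<longleftrightarrow>
    ip x\<^sub>0 x\<^sub>0 \<in> multiplicative_domain \<phi> \<and>
    (\<forall>b. \<phi> (b\<^sup>\<star> * ip x\<^sub>0 x\<^sub>0 * b) = \<phi> (b\<^sup>\<star>) o\<^sub>L \<phi> (ip x\<^sub>0 x\<^sub>0) o\<^sub>L \<phi> b)"
proof -
  interpret hilbert_module act ip by fact
  define p where "p = ip x\<^sub>0 x\<^sub>0"
  have ip_act_left: "ip (act x b) y = b\<^sup>\<star> * ip x y" for x y b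
    by (metis ip_star ip_act_right star_mult)
  have gram: "cinner (\<Phi> x h) (\<Phi> y k) = cinner h (\<phi> (ip x y) k)" for x y h k
  proof -
    have "\<Phi> x \<in> bounded_ops" and "adj (\<Phi> x) o\<^sub>L \<Phi> y = \<phi> (ip x y)"
      using assms(5) by (auto simp: phi_map_def)
    then show ?thesis
      using cinner_adj [of "\<Phi> x" h "\<Phi> y k"] by (metis blinfun_apply_blinfun_compose)
  qed
  note hermitian = completely_positive_hermitian [OF assms(4) assms(2) assms(3)]
  show ?thesis
    unfolding p_def [symmetric]
  proof (intro iffI conjI allI)
    assume "x\<^sub>0 \<in> module_domain act \<phi> \<Phi>"
    then have mod: "\<Phi> (act x\<^sub>0 b) h = \<Phi> x\<^sub>0 (\<phi> b h)" for b h
      by (simp add: module_domain_def)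
    have right: "\<phi> (p * b) = \<phi> p o\<^sub>L \<phi> b" for b
    proof (rule blinfun_eqI, rule cinner_ext_right)
      fix h k
      have "cinner h (\<phi> (p * b) k) = cinner (\<Phi> x\<^sub>0 h) (\<Phi> (act x\<^sub>0 b) k)"
        by (simp add: gram ip_act_right p_def)
      then show "cinner h (\<phi> (p * b) k) = cinner h ((\<phi> p o\<^sub>L \<phi> b) k)"
        by (simp add: mod gram p_def)
    qed
    have left: "\<phi> (b * p) = \<phi> b o\<^sub>L \<phi> p" for b
    proof (rule blinfun_eqI, rule cinner_ext_right)
      fix h k
      have "cinner h (\<phi> (b * p) k) = cinner (\<Phi> (act x\<^sub>0 (b\<^sup>\<star>)) h) (\<Phi> x\<^sub>0 k)"
        by (simp add: gram ip_act_left p_def star_star)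
      then show "cinner h (\<phi> (b * p) k) = cinner h ((\<phi> b o\<^sub>L \<phi> p) k)"
        by (simp add: mod gram p_def hermitian star_star)
    qed
    from left right show "p \<in> multiplicative_domain \<phi>"
      by (simp add: multiplicative_domain_def)
    show "\<phi> (b\<^sup>\<star> * p * b) = \<phi> (b\<^sup>\<star>) o\<^sub>L \<phi> p o\<^sub>L \<phi> b" for b
    proof (rule blinfun_eqI, rule cinner_ext_right)
      fix h k
      have "cinner h (\<phi> (b\<^sup>\<star> * p * b) k) = cinner (\<Phi> (act x\<^sub>0 b) h) (\<Phi> (act x\<^sub>0 b) k)"
        by (simp add: gram ip_act_left ip_act_right p_def mult.assoc)
      then show "cinner h (\<phi> (b\<^sup>\<star> * p * b) k) = cinner h ((\<phi> (b\<^sup>\<star>) o\<^sub>L \<phi> p o\<^sub>L \<phi> b) k)"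
        by (simp add: mod gram p_def hermitian)
    qed
  next
    assume asm: "p \<in> multiplicative_domain \<phi> \<and>
      (\<forall>b. \<phi> (b\<^sup>\<star> * p * b) = \<phi> (b\<^sup>\<star>) o\<^sub>L \<phi> p o\<^sub>L \<phi> b)"
    \<comment> \<open>All four terms in the expansion of the squared norm of the difference agree.\<close>
    have "\<Phi> (act x\<^sub>0 b) = \<Phi> x\<^sub>0 o\<^sub>L \<phi> b" for b
    proof (rule blinfun_eqI)
      fix h
      define e where "e = cinner h (\<phi> (b\<^sup>\<star>) (\<phi> p (\<phi> b h)))"
      have "cinner (\<Phi> (act x\<^sub>0 b) h) (\<Phi> (act x\<^sub>0 b) h) = e"
        "cinner (\<Phi> (act x\<^sub>0 b) h) (\<Phi> x\<^sub>0 (\<phi> b h)) = e"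
        "cinner (\<Phi> x\<^sub>0 (\<phi> b h)) (\<Phi> (act x\<^sub>0 b) h) = e"
        "cinner (\<Phi> x\<^sub>0 (\<phi> b h)) (\<Phi> x\<^sub>0 (\<phi> b h)) = e"
        using asm by (simp_all add: gram ip_act_left ip_act_right hermitian e_def
            multiplicative_domain_def flip: p_def mult.assoc)
      then have "cinner (\<Phi> (act x\<^sub>0 b) h - \<Phi> x\<^sub>0 (\<phi> b h)) (\<Phi> (act x\<^sub>0 b) h - \<Phi> x\<^sub>0 (\<phi> b h)) = 0"
        by (simp add: cinner_diff_left cinner_diff_right)
      then show "\<Phi> (act x\<^sub>0 b) h = (\<Phi> x\<^sub>0 o\<^sub>L \<phi> b) h"
        by (simp add: cinner_self)
    qed
    then show "x\<^sub>0 \<in> module_domain act \<phi> \<Phi>"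
      by (simp add: module_domain_def)
  qed
qed

end
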